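(* Let $\mathcal D$ be a finite family of digraphs, each of whose underlying graph is $4$-colorable. Then $$\left|G\left[\operatorname{core}\left(\prod_{D\in\mathcal D}D\right)\right]\right|\le\left|\operatorname{core}\left(\prod_{D\in\mathcal D}G[D]\right)\right|.$$
   Context: All digraphs and graphs are finite, without loops and without parallel arcs/edges; digons (pairs of opposite arcs) are allowed in digraphs. $|X|$ is the number of vertices of $X$. A homomorphism of (di)graphs is a vertex map sending edges to edges (arcs to arcs, preserving direction). $\prod$ is the tensor product: the vertex set is the Cartesian product, with an edge (arc) between $(u_i)_i$ and $(v_i)_i$ iff $u_iv_i$ is an edge (arc) in every coordinate. $\operatorname{core}(X)$ is the (di)graph with the fewest vertices that is homomorphically equivalent to $X$ (homomorphisms in both directions); it is unique up to isomorphism. The graph $K_2\vee C_5$ is the complete join of $K_2$ and the $5$-cycle $C_5$: their disjoint union together with all edges between them. Given a digraph $D$, the (undirected) graph $G[D]$ is built by replacing each arc $u\to v$ of $D$ with its own (vertex-disjoint) copy of $K_2\vee C_5$, where the head $v$ is identified with a vertex of the $K_2$ part and the tail $u$ is identified with a vertex of the $C_5$ part; copies corresponding to distinct arcs share only vertices of $D$. *)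

theory Defs
  imports "Graph_Theory.Digraph_Component" "HOL-Library.FuncSet"
begin

text \<open>
  A finite digraph without loops and parallel arcs is a \<^locale>\<open>pair_digraph\<close>; the pair
  \<open>(u, v)\<close> is the arc with tail \<open>u\<close> and head \<open>v\<close>. A finite simple graph is a
  \<^locale>\<open>pair_graph\<close>, that is, a symmetric such digraph.
\<close>

definition hom :: "'a pair_pre_digraph \<Rightarrow> 'b pair_pre_digraph \<Rightarrow> ('a \<Rightarrow> 'b) \<Rightarrow> bool" where
  "hom X Y f \<longleftrightarrow> (\<forall>u \<in> pverts X. f u \<in> pverts Y) \<and> (\<forall>(u, v) \<in> parcs X. (f u, f v) \<in> parcs Y)"

definition hom_equiv :: "'a pair_pre_digraph \<Rightarrow> 'b pair_pre_digraph \<Rightarrow> bool" where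
  "hom_equiv X Y \<longleftrightarrow> (\<exists>f. hom X Y f) \<and> (\<exists>g. hom Y X g)"

text \<open>
  Cores are determined only up to isomorphism, so they are given by a relation:
  \<open>C\<close> is a core of \<open>X\<close>. The competitors range over digraphs (graphs) on natural numbers,
  since a formula cannot quantify over types; every finite digraph has a copy of this kind, and
  \<open>is_core_digraph_le\<close> and \<open>is_core_graph_le\<close> below give minimality among
  competitors on any type.
\<close>

definition is_core_digraph :: "'c pair_pre_digraph \<Rightarrow> 'a pair_pre_digraph \<Rightarrow> bool" where
  "is_core_digraph C X \<longleftrightarrow> pair_digraph C \<and> hom_equiv C X \<and>
     (\<forall>C' :: nat pair_pre_digraph. pair_digraph C' \<and> hom_equiv C' X \<longrightarrow>
        card (pverts C) \<le> card (pverts C'))"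

definition is_core_graph :: "'c pair_pre_digraph \<Rightarrow> 'a pair_pre_digraph \<Rightarrow> bool" where
  "is_core_graph C X \<longleftrightarrow> pair_graph C \<and> hom_equiv C X \<and>
     (\<forall>C' :: nat pair_pre_digraph. pair_graph C' \<and> hom_equiv C' X \<longrightarrow>
        card (pverts C) \<le> card (pverts C'))"

text \<open>
  For \<open>I = {}\<close> the product is a single vertex with a loop. It is homomorphically equivalent to no
  loopless digraph and so has no core in the sense above.
\<close>

definition tensor_prod :: "'i set \<Rightarrow> ('i \<Rightarrow> 'a pair_pre_digraph) \<Rightarrow> ('i \<Rightarrow> 'a) pair_pre_digraph" where
  "tensor_prod I X =
     \<lparr> pverts = (\<Pi>\<^sub>E i\<in>I. pverts (X i)),
       parcs = {(u, v). u \<in> (\<Pi>\<^sub>E i\<in>I. pverts (X i)) \<and> v \<in> (\<Pi>\<^sub>E i\<in>I. pverts (X i)) \<and>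
                        (\<forall>i\<in>I. (u i, v i) \<in> parcs (X i))} \<rparr>"

definition colorable :: "nat \<Rightarrow> 'a pair_pre_digraph \<Rightarrow> bool" where
  "colorable k X \<longleftrightarrow>
     (\<exists>c :: 'a \<Rightarrow> nat. c ` pverts X \<subseteq> {..<k} \<and> (\<forall>(u, v) \<in> parcs X. c u \<noteq> c v))"

definition graph_join :: "'a pair_pre_digraph \<Rightarrow> 'b pair_pre_digraph \<Rightarrow> ('a + 'b) pair_pre_digraph" where
  "graph_join X Y =
     \<lparr> pverts = Inl ` pverts X \<union> Inr ` pverts Y,
       parcs = map_prod Inl Inl ` parcs X \<union> map_prod Inr Inr ` parcs Y \<union>
               {(Inl x, Inr y) | x y. x \<in> pverts X \<and> y \<in> pverts Y} \<union>
               {(Inr y, Inl x) | x y. x \<in> pverts X \<and> y \<in> pverts Y} \<rparr>"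

definition K2 :: "nat pair_pre_digraph" where
  "K2 = \<lparr> pverts = {0, 1}, parcs = {(0, 1), (1, 0)} \<rparr>"

definition C5 :: "nat pair_pre_digraph" where
  "C5 = \<lparr> pverts = {..<5},
          parcs = {(i, j). i < 5 \<and> j < 5 \<and> (j = (i + 1) mod 5 \<or> i = (j + 1) mod 5)} \<rparr>"

definition K2_join_C5 :: "(nat + nat) pair_pre_digraph" where
  "K2_join_C5 = graph_join K2 C5"

text \<open>
  The vertices of \<open>G[D]\<close> are the vertices of \<open>D\<close> and, for each arc of \<open>D\<close>, the vertices of
  its copy of \<open>K\<^sub>2 \<or> C\<^sub>5\<close> that are not identified with an end of the arc.
  The function \<open>place (u, v)\<close> embeds the copy belonging to the arc \<open>(u, v)\<close>: the vertex
  \<open>Inl 0\<close> of the \<open>K\<^sub>2\<close> part is identified with the head \<open>v\<close> and the vertex \<open>Inr 0\<close> of the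
  \<open>C\<^sub>5\<close> part with the tail \<open>u\<close>. By symmetry of \<open>K\<^sub>2\<close> and \<open>C\<^sub>5\<close> the choice of these two vertices
  does not matter.
\<close>

datatype 'a gvertex = Orig 'a | Inner "'a \<times> 'a" "nat + nat"

definition place :: "'a \<times> 'a \<Rightarrow> nat + nat \<Rightarrow> 'a gvertex" where
  "place e x = (if x = Inl 0 then Orig (snd e) else if x = Inr 0 then Orig (fst e) else Inner e x)"

definition G_of :: "'a pair_pre_digraph \<Rightarrow> 'a gvertex pair_pre_digraph" where
  "G_of D =
     \<lparr> pverts = Orig ` pverts D \<union> (\<Union>e \<in> parcs D. place e ` pverts K2_join_C5),
       parcs = (\<Union>e \<in> parcs D. map_prod (place e) (place e) ` parcs K2_join_C5) \<rparr>"


lemma hom_comp: "hom X Y f \<Longrightarrow> hom Y Z g \<Longrightarrow> hom X Z (g \<circ> f)"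
  by (fastforce simp: hom_def)

lemma hom_equiv_trans: "hom_equiv X Y \<Longrightarrow> hom_equiv Y Z \<Longrightarrow> hom_equiv X Z"
  unfolding hom_equiv_def by (meson hom_comp)

lemma pair_digraph_iff:
  "pair_digraph X \<longleftrightarrow> finite (pverts X) \<and> parcs X \<subseteq> pverts X \<times> pverts X \<and>
     (\<forall>(u, v) \<in> parcs X. u \<noteq> v)"
proof
  assume "pair_digraph X"
  then interpret pair_digraph X .
  show "finite (pverts X) \<and> parcs X \<subseteq> pverts X \<times> pverts X \<and> (\<forall>(u, v) \<in> parcs X. u \<noteq> v)"
    using pair_finite_verts pair_no_loops by (fastforce dest: in_arcsD1 in_arcsD2)
next
  assume *: "finite (pverts X) \<and> parcs X \<subseteq> pverts X \<times> pverts X \<and> (\<forall>(u, v) \<in> parcs X. u \<noteq> v)"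
  then have "finite (parcs X)" by (meson finite_SigmaI finite_subset)
  with * show "pair_digraph X" by unfold_locales auto
qed

lemma pair_graph_iff: "pair_graph X \<longleftrightarrow> pair_digraph X \<and> sym (parcs X)"
proof
  assume "pair_graph X"
  then interpret pair_graph X .
  show "pair_digraph X \<and> sym (parcs X)"
    using pair_digraph_axioms pair_sym_arcs by (simp add: symmetric_def)
next
  assume *: "pair_digraph X \<and> sym (parcs X)"
  then interpret pair_digraph X by simp
  show "pair_graph X" using * by unfold_locales (simp add: symmetric_def)
qed

lemma nat_copy:
  assumes "pair_digraph X"
  obtains Y :: "nat pair_pre_digraph" where "pair_digraph Y" "hom_equiv Y X"
    "card (pverts Y) = card (pverts X)" "sym (parcs X) \<Longrightarrow> sym (parcs Y)"
proof -
  have fin: "finite (pverts X)" and sub: "parcs X \<subseteq> pverts X \<times> pverts X"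
    and irr: "\<forall>(u, v) \<in> parcs X. u \<noteq> v"
    using assms by (auto simp: pair_digraph_iff)
  obtain f :: "_ \<Rightarrow> nat" where inj: "inj_on f (pverts X)"
    using finite_imp_inj_to_nat_seg[OF fin] by blast
  define Y where "Y = \<lparr> pverts = f ` pverts X, parcs = map_prod f f ` parcs X \<rparr>"
  have "pair_digraph Y"
    using fin sub irr inj unfolding pair_digraph_iff Y_def by (fastforce dest: inj_onD)
  moreover have "hom X Y f" by (auto simp: hom_def Y_def)
  moreover have "hom Y X (inv_into (pverts X) f)"
    using sub inj by (fastforce simp: hom_def Y_def)
  moreover have "card (pverts Y) = card (pverts X)"
    using inj by (simp add: Y_def card_image)
  moreover have "sym (parcs X) \<Longrightarrow> sym (parcs Y)"
    by (fastforce simp: sym_def Y_def)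
  ultimately show ?thesis using that unfolding hom_equiv_def by blast
qed

lemma is_core_digraph_le:
  assumes "is_core_digraph C X" "pair_digraph C'" "hom_equiv C' X"
  shows "card (pverts C) \<le> card (pverts C')"
proof -
  obtain Y :: "nat pair_pre_digraph" where Y: "pair_digraph Y" "hom_equiv Y C'"
    "card (pverts Y) = card (pverts C')"
    using nat_copy[OF assms(2)] by blast
  with assms show ?thesis using hom_equiv_trans[OF Y(2) assms(3)]
    unfolding is_core_digraph_def by fastforce
qed

lemma is_core_graph_le:
  assumes "is_core_graph C X" "pair_graph C'" "hom_equiv C' X"
  shows "card (pverts C) \<le> card (pverts C')"
proof -
  have C': "pair_digraph C'" "sym (parcs C')" using assms(2) by (auto simp: pair_graph_iff)
  obtain Y :: "nat pair_pre_digraph" where Y: "pair_digraph Y" "hom_equiv Y C'"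
    "card (pverts Y) = card (pverts C')" "sym (parcs Y)"
    using nat_copy[OF C'(1)] C'(2) by blast
  then have "pair_graph Y" by (simp add: pair_graph_iff)
  with assms Y show ?thesis using hom_equiv_trans[OF Y(2) assms(3)]
    unfolding is_core_graph_def by fastforce
qed

lemma is_core_digraph_exists:
  assumes "pair_digraph X"
  shows "\<exists>C :: nat pair_pre_digraph. is_core_digraph C X"
proof -
  obtain Y :: "nat pair_pre_digraph" where "pair_digraph Y \<and> hom_equiv Y X"
    using nat_copy[OF assms] by blast
  from ex_has_least_nat[of "\<lambda>Y. pair_digraph Y \<and> hom_equiv Y X" Y "\<lambda>Y. card (pverts Y)", OF this]
  show ?thesis by (simp add: is_core_digraph_def)
qed

lemma is_core_graph_exists:
  assumes "pair_graph X"
  shows "\<exists>C :: nat pair_pre_digraph. is_core_graph C X"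
proof -
  have X: "pair_digraph X" "sym (parcs X)" using assms by (auto simp: pair_graph_iff)
  obtain Y :: "nat pair_pre_digraph" where "pair_graph Y \<and> hom_equiv Y X"
    using nat_copy[OF X(1)] X(2) unfolding pair_graph_iff by blast
  from ex_has_least_nat[of "\<lambda>Y. pair_graph Y \<and> hom_equiv Y X" Y "\<lambda>Y. card (pverts Y)", OF this]
  show ?thesis by (simp add: is_core_graph_def)
qed

lemma pair_digraph_tensor_prod:
  assumes "finite I" "I \<noteq> {}" "\<And>i. i \<in> I \<Longrightarrow> pair_digraph (X i)"
  shows "pair_digraph (tensor_prod I X)"
proof -
  have "finite (\<Pi>\<^sub>E i\<in>I. pverts (X i))"
    using assms by (intro finite_PiE) (auto simp: pair_digraph_iff)
  moreover have "u \<noteq> v" if "\<forall>i\<in>I. (u i, v i) \<in> parcs (X i)" for u v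
    using that assms(2,3) unfolding pair_digraph_iff by fast
  ultimately show ?thesis by (auto simp: pair_digraph_iff tensor_prod_def)
qed

lemma pair_graph_tensor_prod:
  assumes "finite I" "I \<noteq> {}" "\<And>i. i \<in> I \<Longrightarrow> pair_graph (X i)"
  shows "pair_graph (tensor_prod I X)"
proof -
  have "pair_digraph (tensor_prod I X)"
    using assms by (intro pair_digraph_tensor_prod) (auto simp: pair_graph_iff)
  moreover have "sym (parcs (tensor_prod I X))"
    using assms(3) by (auto simp: tensor_prod_def pair_graph_iff sym_def)
  ultimately show ?thesis by (simp add: pair_graph_iff)
qed

lemma pair_graph_K2_join_C5: "pair_graph K2_join_C5"
proof -
  have "i \<noteq> Suc i mod 5" if "i < 5" for i :: nat
    using that by (cases "i = 4") auto
  then show ?thesis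
    unfolding pair_graph_iff pair_digraph_iff K2_join_C5_def graph_join_def K2_def C5_def sym_def
    by (auto simp: image_iff)
qed

lemma pair_graph_G_of:
  assumes "pair_digraph D"
  shows "pair_graph (G_of D)"
proof -
  have W: "finite (pverts K2_join_C5)" "parcs K2_join_C5 \<subseteq> pverts K2_join_C5 \<times> pverts K2_join_C5"
    "\<forall>(x, y) \<in> parcs K2_join_C5. x \<noteq> y" "sym (parcs K2_join_C5)"
    using pair_graph_K2_join_C5 by (auto simp: pair_graph_iff pair_digraph_iff)
  interpret pair_digraph D by fact
  have D: "finite (pverts D)" "finite (parcs D)" "\<And>u v. (u, v) \<in> parcs D \<Longrightarrow> u \<noteq> v"
    using pair_finite_verts pair_finite_arcs by (auto dest: pair_no_loops)
  have "x = y" if "place e x = place e y" "e \<in> parcs D" for e x y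
    using that D(3) by (cases e) (auto simp: place_def split: if_splits)
  with W D have "pair_digraph (G_of D)"
    unfolding pair_digraph_iff G_of_def by fastforce
  moreover have "sym (parcs (G_of D))"
    using W(4) by (fastforce simp: sym_def G_of_def)
  ultimately show ?thesis by (simp add: pair_graph_iff)
qed

end

theory Submission
  imports Defs
begin

text \<open>
  The graph \<open>W = K\<^sub>2 \<or> C\<^sub>5\<close> is \<open>5\<close>-vertex-critical, and no union of two independent
  sets separates it. If \<open>D\<close> is \<open>4\<close>-colorable, every homomorphism \<open>W \<rightarrow> G[D]\<close>
  therefore maps \<open>W\<close> isomorphically onto a single gadget, respecting the \<open>K\<^sub>2\<close> and \<open>C\<^sub>5\<close> parts.
  Retracting the \<open>K\<^sub>2\<close> part of each gadget to its head and the \<open>C\<^sub>5\<close> part to its tail turns a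
  homomorphism \<open>G[X] \<rightarrow> G[D]\<close> into a homomorphism \<open>X \<rightarrow> D\<close>.

  Let \<open>C\<close> be the core of \<open>\<Prod>D\<^sub>i\<close> and \<open>H\<close> that of \<open>\<Prod>G[D\<^sub>i]\<close>. A homomorphism
  \<open>F : G[C] \<rightarrow> \<Prod>G[D\<^sub>i]\<close> retracts in each coordinate, giving \<open>C \<rightarrow> \<Prod>D\<^sub>i\<close>, which is injective
  because \<open>C\<close> is a core; this forces \<open>F\<close> to be injective. Applied to a composite
  \<open>G[C] \<rightarrow> H \<rightarrow> \<Prod>G[D\<^sub>i]\<close>, it shows that \<open>G[C]\<close> injects into \<open>H\<close>.
\<close>

subsection \<open>The graph \<open>K\<^sub>2 \<or> C\<^sub>5\<close>\<close>

lemma parcs_K2_join_C5: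
  "(x, y) \<in> parcs K2_join_C5 \<longleftrightarrow> x \<in> pverts K2_join_C5 \<and> y \<in> pverts K2_join_C5 \<and> x \<noteq> y \<and>
     (\<forall>i j. x = Inr i \<and> y = Inr j \<longrightarrow> j = (i + 1) mod 5 \<or> i = (j + 1) mod 5)"
proof -
  have "Suc i mod 5 \<noteq> i \<and> i \<noteq> Suc i mod 5" if "i < 5" for i :: nat
    using that by (cases "i = 4") auto
  then show ?thesis
    by (cases x; cases y) (auto simp: K2_join_C5_def graph_join_def K2_def C5_def image_iff)
qed

lemma pverts_K2_join_C5: "pverts K2_join_C5 = {Inl 0, Inl 1} \<union> Inr ` {..<5}"
  by (auto simp: K2_join_C5_def graph_join_def K2_def C5_def)

lemma less_5_cases: "(i :: nat) < 5 \<longleftrightarrow> i = 0 \<or> i = 1 \<or> i = 2 \<or> i = 3 \<or> i = 4"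
  by auto

text \<open>The two vertices of \<open>K2\<close> use up two colors, leaving two for an odd
  cycle.\<close>

lemma not_colorable_K2_join_C5: "\<not> colorable 4 K2_join_C5"
proof
  assume "colorable 4 K2_join_C5"
  then obtain c :: "nat + nat \<Rightarrow> nat" where lt: "\<And>x. x \<in> pverts K2_join_C5 \<Longrightarrow> c x < 4"
    and ne: "\<And>x y. (x, y) \<in> parcs K2_join_C5 \<Longrightarrow> c x \<noteq> c y"
    unfolding colorable_def by fastforce
  have ab: "c (Inl 0) \<noteq> c (Inl 1)"
    by (rule ne) (auto simp: parcs_K2_join_C5 pverts_K2_join_C5)
  have "card ({..<4} - {c (Inl 0), c (Inl 1)}) = 2"
    using ab lt by (subst card_Diff_subset) (auto simp: pverts_K2_join_C5)
  then obtain p q where pq: "{..<4} - {c (Inl 0), c (Inl 1)} = {p, q}"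
    by (auto simp: card_2_iff)
  have "c (Inr i) \<in> {p, q}" if "i < 5" for i
  proof -
    have "c (Inl 0) \<noteq> c (Inr i)" "c (Inl 1) \<noteq> c (Inr i)" "c (Inr i) < 4"
      using that by (auto intro!: ne lt simp: parcs_K2_join_C5 pverts_K2_join_C5)
    then have "c (Inr i) \<in> {..<4} - {c (Inl 0), c (Inl 1)}" by simp
    then show ?thesis unfolding pq .
  qed
  moreover have "c (Inr i) \<noteq> c (Inr ((i + 1) mod 5))" if "i < 5" for i
    using that by (intro ne) (auto simp: parcs_K2_join_C5 pverts_K2_join_C5 less_5_cases)
  ultimately have alt: "(c (Inr i) = p) \<noteq> (c (Inr ((i + 1) mod 5)) = p)" if "i < 5" for i
    using that by (metis empty_iff insert_iff mod_less_divisor zero_less_numeral)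
  define b where "b i = (c (Inr i) = p)" for i
  have "b 0 \<noteq> b 1" "b 1 \<noteq> b 2" "b 2 \<noteq> b 3" "b 3 \<noteq> b 4" "b 4 \<noteq> b 0"
    unfolding b_def using alt[of 0] alt[of 1] alt[of 2] alt[of 3] alt[of 4]
    by (simp_all add: numeral_2_eq_2)
  then show False by blast
qed

lemma K2_join_C5_vertex_critical:
  assumes "z \<in> pverts K2_join_C5"
  obtains c :: "nat + nat \<Rightarrow> nat" where "\<And>x. x \<in> pverts K2_join_C5 \<Longrightarrow> c x < 4"
    and "\<And>x y. (x, y) \<in> parcs K2_join_C5 \<Longrightarrow> x \<noteq> z \<Longrightarrow> y \<noteq> z \<Longrightarrow> c x \<noteq> c y"
proof (cases z)
  case (Inl j)
  show ?thesis
  proof (rule that)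
    \<comment> \<open>One \<open>Inl\<close> vertex is \<open>z\<close>, so the other can have color
      3 to itself; the cycle is colored 0, 1, 0, 1, 2.\<close>
    let ?c = "case_sum (\<lambda>_. 3) (\<lambda>i. if i = 4 then 2 else i mod 2) :: nat + nat \<Rightarrow> nat"
    have "i mod 2 < 4" for i :: nat by presburger
    then show "?c x < 4" for x by (cases x) auto
    show "?c x \<noteq> ?c y" if "(x, y) \<in> parcs K2_join_C5" "x \<noteq> z" "y \<noteq> z" for x y
      using that Inl assms
      by (auto simp: parcs_K2_join_C5 pverts_K2_join_C5 less_5_cases)
  qed
next
  case (Inr j)
  show ?thesis
  proof (rule that)
    \<comment> \<open>Without \<open>j\<close> the cycle is a path, colored by the parity of the
      distance travelled from \<open>j\<close>; the \<open>K2\<close> part takes the colors 2 and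
      3.\<close>
    let ?c = "case_sum (\<lambda>i. i + 2) (\<lambda>i. ((i + 5 - j) mod 5) mod 2) :: nat + nat \<Rightarrow> nat"
    show "?c x < 4" if "x \<in> pverts K2_join_C5" for x
      using that by (auto simp: pverts_K2_join_C5)
    show "?c x \<noteq> ?c y" if "(x, y) \<in> parcs K2_join_C5" "x \<noteq> z" "y \<noteq> z" for x y
      using that Inr assms
      by (auto simp: parcs_K2_join_C5 pverts_K2_join_C5 less_5_cases)
  qed
qed

section \<open>Endomorphisms of \<open>K2_join_C5\<close>\<close>

lemma hom_not_colorable:
  assumes "hom X Y f" "\<not> colorable k X"
  shows "\<not> colorable k Y"
proof
  assume "colorable k Y"
  then obtain c where c: "c ` pverts Y \<subseteq> {..<k}" "\<forall>(u, v) \<in> parcs Y. c u \<noteq> c v"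
    unfolding colorable_def by blast
  then have "(c \<circ> f) ` pverts X \<subseteq> {..<k}" "\<forall>(u, v) \<in> parcs X. (c \<circ> f) u \<noteq> (c \<circ> f) v"
    using assms(1) by (fastforce simp: hom_def)+
  with assms(2) show False unfolding colorable_def by blast
qed

text \<open>If \<open>f\<close> missed a vertex \<open>z\<close>, a 4-coloring of the graph without
  \<open>z\<close> would pull back along \<open>f\<close>.\<close>

lemma hom_K2_join_C5_endo:
  assumes "hom K2_join_C5 K2_join_C5 f"
  shows "f ` pverts K2_join_C5 = pverts K2_join_C5"
proof (rule ccontr)
  let ?V = "pverts K2_join_C5"
  have im: "f ` ?V \<subseteq> ?V" and arc: "\<And>x y. (x, y) \<in> parcs K2_join_C5 \<Longrightarrow> (f x, f y) \<in> parcs K2_join_C5"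
    using assms by (auto simp: hom_def)
  assume "f ` ?V \<noteq> ?V"
  then obtain z where z: "z \<in> ?V" "z \<notin> f ` ?V" using im by blast
  obtain c :: "nat + nat \<Rightarrow> nat" where c: "\<And>x. x \<in> ?V \<Longrightarrow> c x < 4"
    "\<And>x y. (x, y) \<in> parcs K2_join_C5 \<Longrightarrow> x \<noteq> z \<Longrightarrow> y \<noteq> z \<Longrightarrow> c x \<noteq> c y"
    using K2_join_C5_vertex_critical[OF z(1)] by metis
  have "(c \<circ> f) x \<noteq> (c \<circ> f) y" if xy: "(x, y) \<in> parcs K2_join_C5" for x y
  proof -
    have "x \<in> ?V" "y \<in> ?V" using xy by (auto simp: parcs_K2_join_C5)
    then have "f x \<noteq> z" "f y \<noteq> z" using z(2) by blast+
    then show ?thesis using c(2)[OF arc[OF xy]] by simp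
  qed
  moreover have "(c \<circ> f) ` ?V \<subseteq> {..<4}" using c(1) im by auto
  ultimately have "colorable 4 K2_join_C5" unfolding colorable_def by blast
  with not_colorable_K2_join_C5 show False ..
qed

text \<open>Surjectivity on a finite set gives injectivity. A vertex adjacent to all others has an
  image adjacent to all others, hence in the \<open>K2\<close> part; this fills that part, so the
  cycle must go to the cycle.\<close>

lemma
  assumes "hom K2_join_C5 K2_join_C5 f"
  shows inj_on_K2_join_C5_endo: "inj_on f (pverts K2_join_C5)"
    and K2_join_C5_endo_Inl: "Inl i \<in> pverts K2_join_C5 \<Longrightarrow> \<exists>j. f (Inl i) = Inl j"
    and K2_join_C5_endo_Inr: "Inr i \<in> pverts K2_join_C5 \<Longrightarrow> \<exists>j. f (Inr i) = Inr j"
proof -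
  let ?V = "pverts K2_join_C5"
  have im: "f ` ?V = ?V" by (rule hom_K2_join_C5_endo[OF assms])
  have arc: "(f x, f y) \<in> parcs K2_join_C5" if "(x, y) \<in> parcs K2_join_C5" for x y
    using assms that by (auto simp: hom_def)
  have "finite ?V" by (simp add: pverts_K2_join_C5)
  then show inj: "inj_on f ?V" by (rule eq_card_imp_inj_on) (simp add: im)
  have l: "\<exists>j. f (Inl i) = Inl j" if i: "Inl i \<in> ?V" for i
  proof (cases "f (Inl i)")
    case (Inr j)
    have "Inr j \<in> ?V" using im i Inr by (metis imageI)
    then have j: "j < 5" by (auto simp: pverts_K2_join_C5)
    \<comment> \<open>A cycle vertex not adjacent to \<open>j\<close>; its preimage is nevertheless
      adjacent to \<open>Inl i\<close>.\<close>
    let ?j = "(j + 2) mod 5"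
    have "Inr ?j \<in> f ` ?V" unfolding im by (simp add: pverts_K2_join_C5)
    then obtain x where x: "x \<in> ?V" "f x = Inr ?j" by fastforce
    have "j \<noteq> ?j" using j by (auto simp: less_5_cases)
    then have "x \<noteq> Inl i" using x Inr by auto
    then have "(Inl i, x) \<in> parcs K2_join_C5" using x i by (simp add: parcs_K2_join_C5)
    from arc[OF this] have False using x Inr j by (auto simp: parcs_K2_join_C5 less_5_cases)
    then show ?thesis ..
  qed auto
  then show "Inl i \<in> ?V \<Longrightarrow> \<exists>j. f (Inl i) = Inl j" .
  show "\<exists>j. f (Inr i) = Inr j" if i: "Inr i \<in> ?V"
  proof (cases "f (Inr i)")
    case (Inl j)
    have V: "Inl 0 \<in> ?V" "Inl 1 \<in> ?V" by (auto simp: pverts_K2_join_C5)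
    obtain p q where pq: "f (Inl 0) = Inl p" "f (Inl 1) = Inl q" using l V by blast
    have "Inl j \<in> ?V" "Inl p \<in> ?V" "Inl q \<in> ?V" using im i V Inl pq by (metis imageI)+
    moreover have "p \<noteq> q" "p \<noteq> j" "q \<noteq> j"
      using inj_onD[OF inj, of "Inl 0" "Inl 1"] inj_onD[OF inj, of "Inl 0" "Inr i"]
        inj_onD[OF inj, of "Inl 1" "Inr i"] V i Inl pq by auto
    ultimately have False by (auto simp: pverts_K2_join_C5)
    then show ?thesis ..
  qed auto
qed

subsection \<open>Homomorphisms between graphs \<open>G[D]\<close>\<close>

text \<open>The two attaching vertices stay distinct because \<open>e\<close> is not a loop.\<close>

lemma inj_place: "pair_digraph D \<Longrightarrow> e \<in> parcs D \<Longrightarrow> place e x = place e y \<Longrightarrow> x = y"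
  by (cases e) (auto simp: place_def pair_digraph_iff split: if_splits)

lemma place_in_G_of: "e \<in> parcs D \<Longrightarrow> x \<in> pverts K2_join_C5 \<Longrightarrow> place e x \<in> pverts (G_of D)"
  by (auto simp: G_of_def)

lemma place_arc_G_of:
  "e \<in> parcs D \<Longrightarrow> (x, y) \<in> parcs K2_join_C5 \<Longrightarrow> (place e x, place e y) \<in> parcs (G_of D)"
  by (fastforce simp: G_of_def)

lemma G_of_vertex_cases:
  assumes "z \<in> pverts (G_of D)"
  obtains u where "z = Orig u" "u \<in> pverts D"
  | e x where "z = place e x" "e \<in> parcs D" "x \<in> pverts K2_join_C5"
  using assms by (auto simp: G_of_def)

lemma place_simps [simp]:
  "place e (Inl 0) = Orig (snd e)" "place e (Inr 0) = Orig (fst e)"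
  by (auto simp: place_def)

text \<open>An inner vertex carries the name of its gadget, so all its neighbors lie in that
  gadget.\<close>

lemma arc_G_of_Inner:
  assumes "(Inner e x, z) \<in> parcs (G_of D)"
  obtains y where "e \<in> parcs D" "z = place e y" "place e x = Inner e x" "(x, y) \<in> parcs K2_join_C5"
proof -
  obtain e' p q where *: "e' \<in> parcs D" "(p, q) \<in> parcs K2_join_C5" "Inner e x = place e' p"
    "z = place e' q"
    using assms by (auto simp: G_of_def)
  then have "e' = e" "p = x" by (auto simp: place_def split: if_splits)
  show ?thesis
    by (rule that[of q]) (use * \<open>e' = e\<close> \<open>p = x\<close> in simp_all)
qed

lemma arc_G_of_Orig:
  assumes "(Orig u, Orig v) \<in> parcs (G_of D)"
  shows "(u, v) \<in> parcs D \<or> (v, u) \<in> parcs D"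
  using assms by (fastforce simp: G_of_def place_def parcs_K2_join_C5 split: if_splits)

text \<open>Gadgets are induced subgraphs: an edge with an inner end belongs to the gadget of that
  end, and the two attaching vertices are adjacent in \<open>K2_join_C5\<close> anyway.\<close>

lemma arc_place_G_of:
  assumes D: "pair_digraph D" and e: "e \<in> parcs D"
    and V: "x \<in> pverts K2_join_C5" "y \<in> pverts K2_join_C5"
    and arc: "(place e x, place e y) \<in> parcs (G_of D)"
  shows "(x, y) \<in> parcs K2_join_C5"
proof -
  have sym: "sym (parcs (G_of D))" "sym (parcs K2_join_C5)"
    using pair_graph_G_of[OF D] pair_graph_K2_join_C5 by (auto simp: pair_graph_iff)
  have *: "(x, y) \<in> parcs K2_join_C5"
    if "(place e x, place e y) \<in> parcs (G_of D)" "x \<noteq> Inl 0" "x \<noteq> Inr 0" for x y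
  proof -
    from that have "(Inner e x, place e y) \<in> parcs (G_of D)" by (simp add: place_def)
    then show ?thesis by (metis arc_G_of_Inner inj_place[OF D e])
  qed
  have "x \<noteq> y"
    using arc pair_graph_G_of[OF D] by (auto simp: pair_graph_iff pair_digraph_iff)
  show ?thesis
  proof (cases "x \<in> {Inl 0, Inr 0} \<and> y \<in> {Inl 0, Inr 0}")
    case True
    then show ?thesis using \<open>x \<noteq> y\<close> V by (auto simp: parcs_K2_join_C5)
  next
    case False
    then show ?thesis using *[OF arc] *[OF symD[OF sym(1) arc]] symD[OF sym(2)] by blast
  qed
qed

text \<open>
  No union of two independent sets separates \<open>K\<^sub>2 \<or> C\<^sub>5\<close>, so a homomorphic image cannot cross
  the edge by which a gadget is attached to the rest of \<open>G[D]\<close>. Below, \<open>S\<close> is the preimage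
  of that edge and \<open>T\<close> the preimage of the interior of the gadget.
\<close>

lemma hom_K2_join_C5_G_of_gadget:
  assumes D: "pair_digraph D" and col: "colorable 4 (mk_symmetric (with_proj D))"
    and f: "hom K2_join_C5 (G_of D) f"
  obtains e where "e \<in> parcs D" "f ` pverts K2_join_C5 \<subseteq> place e ` pverts K2_join_C5"
proof -
  let ?V = "pverts K2_join_C5"
  have arc: "(f x, f y) \<in> parcs (G_of D)" if "(x, y) \<in> parcs K2_join_C5" for x y
    using f that by (auto simp: hom_def)
  have vert: "f x \<in> pverts (G_of D)" if "x \<in> ?V" for x
    using f that by (auto simp: hom_def)
  \<comment> \<open>Otherwise \<open>f\<close> would map into the underlying graph of
    \<open>D\<close>, which is 4-colorable.\<close>
  have "\<exists>z\<in>?V. \<exists>e x. f z = Inner e x"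
  proof (rule ccontr)
    assume "\<not> (\<exists>z\<in>?V. \<exists>e x. f z = Inner e x)"
    then have no: "f z \<noteq> Inner e x" if "z \<in> ?V" for z e x using that by blast
    have orig: "\<exists>u\<in>pverts D. f z = Orig u" if z: "z \<in> ?V" for z
    proof -
      obtain u where u: "f z = Orig u" using no[OF z] by (cases "f z") auto
      with vert[OF z] show ?thesis
        using D by (auto simp: G_of_def place_def pair_digraph_iff split: if_splits)
    qed
    define g where "g z = (THE u. f z = Orig u)" for z
    have g: "f z = Orig (g z)" if "z \<in> ?V" for z
      using orig[OF that] by (auto simp: g_def)
    have "hom K2_join_C5 (mk_symmetric (with_proj D)) g"
      unfolding hom_def
    proof (intro conjI ballI, goal_cases)
      case (1 z)
      then show ?case using orig[of z] g[of z] by auto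
    next
      case (2 a)
      obtain x y where a: "a = (x, y)" by (cases a)
      then have V: "x \<in> ?V" "y \<in> ?V" using 2 by (auto simp: parcs_K2_join_C5)
      then have "(Orig (g x), Orig (g y)) \<in> parcs (G_of D)"
        using arc 2 a g by metis
      from arc_G_of_Orig[OF this] show ?case
        using a by (auto simp: parcs_mk_symmetric intro: bexI[of _ "(g y, g x)"])
    qed
    from hom_not_colorable[OF this not_colorable_K2_join_C5] col show False by blast
  qed
  then obtain z e p where z: "z \<in> ?V" "f z = Inner e p" by blast
  define T where "T = {x \<in> ?V. \<exists>q. f x = Inner e q}"
  define S where "S = {x \<in> ?V. f x = Orig (fst e) \<or> f x = Orig (snd e)}"
  have nb: "y \<in> T \<union> S" if "x \<in> T" "(x, y) \<in> parcs K2_join_C5" for x y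
  proof -
    obtain q where "f x = Inner e q" using \<open>x \<in> T\<close> by (auto simp: T_def)
    then have "(Inner e q, f y) \<in> parcs (G_of D)" using arc[OF that(2)] by simp
    then obtain y' where "f y = place e y'" by (rule arc_G_of_Inner)
    then show ?thesis using that(2)
      by (auto simp: T_def S_def place_def parcs_K2_join_C5 split: if_splits)
  qed
  have zT: "z \<in> T" using z by (auto simp: T_def)
  have V01: "Inl 0 \<in> ?V" "Inl 1 \<in> ?V" by (auto simp: pverts_K2_join_C5)
  have sub: "?V \<subseteq> T \<union> S"
  proof (cases "\<exists>j. Inl j \<in> T")
    case True
    \<comment> \<open>\<open>Inl j\<close> is adjacent to every other vertex, so \<open>nb\<close>
      covers everything at once.\<close>
    then obtain j where j: "Inl j \<in> T" by blast
    show ?thesis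
    proof
      fix y assume "y \<in> ?V"
      then show "y \<in> T \<union> S" using nb[OF j, of y] j
        by (cases "y = Inl j") (auto simp: parcs_K2_join_C5 T_def)
    qed
  next
    case False
    then have zr: "\<exists>i<5. z = Inr i" using zT by (auto simp: T_def pverts_K2_join_C5)
    have "Inl 0 \<in> T \<union> S" "Inl 1 \<in> T \<union> S"
      using nb[OF zT] zr V01 z by (auto simp: parcs_K2_join_C5)
    with False have ab: "Inl 0 \<in> S" "Inl 1 \<in> S" by auto
    have irr: "\<And>w. (w, w) \<notin> parcs (G_of D)"
      using pair_graph_G_of[OF D] by (auto simp: pair_graph_iff pair_digraph_iff)
    \<comment> \<open>The adjacent vertices \<open>Inl 0\<close> and \<open>Inl 1\<close> already
      occupy both ends of the attaching edge, leaving no value for a third vertex adjacent to both.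
      Hence membership in \<open>T\<close> spreads around the whole cycle.\<close>
    have S2: "S \<subseteq> {Inl 0, Inl 1}"
    proof
      fix x assume x: "x \<in> S"
      show "x \<in> {Inl 0, Inl 1}"
      proof (rule ccontr)
        assume "x \<notin> {Inl 0, Inl 1}"
        then have "(x, Inl 0) \<in> parcs K2_join_C5" "(x, Inl 1) \<in> parcs K2_join_C5"
          "(Inl 0, Inl 1) \<in> parcs K2_join_C5"
          using x V01 by (auto simp: parcs_K2_join_C5 S_def)
        then have "f x \<noteq> f (Inl 0)" "f x \<noteq> f (Inl 1)" "f (Inl 0) \<noteq> f (Inl 1)"
          using arc irr by metis+
        then show False using x ab by (auto simp: S_def)
      qed
    qed
    have step: "Inr ((i + 1) mod 5) \<in> T" if "Inr i \<in> T" for i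
    proof -
      have i: "i < 5" using that by (auto simp: T_def pverts_K2_join_C5)
      then have "(Inr i, Inr ((i + 1) mod 5)) \<in> parcs K2_join_C5"
        by (auto simp: parcs_K2_join_C5 pverts_K2_join_C5 less_5_cases)
      from nb[OF that this] S2 show ?thesis by auto
    qed
    have "\<forall>i<5. Inr i \<in> T"
    proof -
      obtain i where i: "i < 5" "Inr i \<in> T" using zr zT by blast
      have "Inr 0 \<in> T \<Longrightarrow> Inr 1 \<in> T" "Inr 1 \<in> T \<Longrightarrow> Inr 2 \<in> T" "Inr 2 \<in> T \<Longrightarrow> Inr 3 \<in> T"
        "Inr 3 \<in> T \<Longrightarrow> Inr 4 \<in> T" "Inr 4 \<in> T \<Longrightarrow> Inr 0 \<in> T"
        using step[of 0] step[of 1] step[of 2] step[of 3] step[of 4]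
        by (simp_all add: numeral_2_eq_2)
      then show ?thesis using i unfolding less_5_cases by blast
    qed
    then show ?thesis using ab by (auto simp: pverts_K2_join_C5)
  qed
  have in_gadget: "\<exists>q\<in>?V. Inner e q = place e q" "e \<in> parcs D"
    if "Inner e q \<in> pverts (G_of D)" for q
    using that by (auto simp: G_of_def place_def split: if_splits)
  have e: "e \<in> parcs D" using vert[OF z(1)] in_gadget(2) z(2) by simp
  have "f x \<in> place e ` ?V" if "x \<in> ?V" for x
  proof -
    from sub that have "x \<in> T \<union> S" by blast
    then show ?thesis
    proof
      assume "x \<in> T"
      then obtain q where q: "f x = Inner e q" by (auto simp: T_def)
      with vert[OF that] show ?thesis
        by (auto simp: G_of_def place_def split: if_splits)
    next
      have "Inr 0 \<in> ?V" by (simp add: pverts_K2_join_C5)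
      moreover assume "x \<in> S"
      ultimately show ?thesis
        using V01(1) place_simps(1)[of e] place_simps(2)[of e]
        unfolding S_def by (metis (mono_tags, lifting) imageI mem_Collect_eq)
    qed
  qed
  with e that show ?thesis by blast
qed

lemma hom_K2_join_C5_G_of:
  assumes D: "pair_digraph D" and col: "colorable 4 (mk_symmetric (with_proj D))"
    and f: "hom K2_join_C5 (G_of D) f"
  obtains e h where "e \<in> parcs D" "hom K2_join_C5 K2_join_C5 h"
    "\<And>x. x \<in> pverts K2_join_C5 \<Longrightarrow> f x = place e (h x)"
proof -
  let ?V = "pverts K2_join_C5"
  obtain e where e: "e \<in> parcs D" "f ` ?V \<subseteq> place e ` ?V"
    using hom_K2_join_C5_G_of_gadget[OF assms] .
  then have "\<forall>x\<in>?V. \<exists>y\<in>?V. f x = place e y" by auto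
  then obtain h where h: "\<And>x. x \<in> ?V \<Longrightarrow> h x \<in> ?V" "\<And>x. x \<in> ?V \<Longrightarrow> f x = place e (h x)"
    by metis
  have "(h x, h y) \<in> parcs K2_join_C5" if xy: "(x, y) \<in> parcs K2_join_C5" for x y
  proof -
    have V: "x \<in> ?V" "y \<in> ?V" using xy by (auto simp: parcs_K2_join_C5)
    have "(f x, f y) \<in> parcs (G_of D)" using f xy by (auto simp: hom_def)
    then show ?thesis using arc_place_G_of[OF D e(1)] h V by simp
  qed
  then have "hom K2_join_C5 K2_join_C5 h" using h(1) by (auto simp: hom_def)
  with e(1) h(2) that show ?thesis by blast
qed

section \<open>Retracting gadgets to the ends of their arcs\<close>

fun retract :: "'a gvertex \<Rightarrow> 'a" where
  "retract (Orig u) = u"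
| "retract (Inner e (Inl _)) = snd e"
| "retract (Inner e (Inr _)) = fst e"

lemma retract_place [simp]:
  "retract (place e (Inl i)) = snd e" "retract (place e (Inr i)) = fst e"
  by (auto simp: place_def)

lemma Orig_retract_Inner: "\<exists>q\<in>pverts K2_join_C5. Orig (retract (Inner e x)) = place e q"
proof (cases x)
  case (Inl i)
  then show ?thesis by (intro bexI[of _ "Inl 0"]) (auto simp: pverts_K2_join_C5)
next
  case (Inr i)
  then show ?thesis by (intro bexI[of _ "Inr 0"]) (auto simp: pverts_K2_join_C5)
qed

lemma retract_in_pverts:
  assumes "pair_digraph D" "z \<in> pverts (G_of D)"
  shows "retract z \<in> pverts D"
  using assms(2)
proof (cases rule: G_of_vertex_cases)
  case (2 e x)
  then show ?thesis using assms(1) by (cases x) (auto simp: pair_digraph_iff)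
qed simp

text \<open>\<open>F\<close> carries each gadget onto one gadget, and \<open>h\<close> respects the
  two parts, so the head and tail of the target arc are the retracts of the images of
  \<open>v\<close> and \<open>u\<close>. In particular \<open>g\<close> preserves arcs.\<close>

lemma hom_G_of_place:
  assumes D: "pair_digraph D" and col: "colorable 4 (mk_symmetric (with_proj D))"
    and F: "hom (G_of X) (G_of D) F" and a: "(u, v) \<in> parcs X"
  defines "g \<equiv> \<lambda>u. retract (F (Orig u))"
  obtains h where "(g u, g v) \<in> parcs D" "hom K2_join_C5 K2_join_C5 h"
    "\<And>x. x \<in> pverts K2_join_C5 \<Longrightarrow> F (place (u, v) x) = place (g u, g v) (h x)"
proof -
  let ?V = "pverts K2_join_C5"
  have "hom K2_join_C5 (G_of X) (place (u, v))"
    using a by (auto simp: hom_def place_in_G_of place_arc_G_of)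
  from hom_comp[OF this F]
  obtain e h where e: "e \<in> parcs D" and h: "hom K2_join_C5 K2_join_C5 h"
    and eq: "\<And>x. x \<in> ?V \<Longrightarrow> (F \<circ> place (u, v)) x = place e (h x)"
    using hom_K2_join_C5_G_of[OF D col] by metis
  have V: "Inl 0 \<in> ?V" "Inr 0 \<in> ?V" by (auto simp: pverts_K2_join_C5)
  obtain i j where "h (Inl 0) = Inl i" "h (Inr 0) = Inr j"
    using K2_join_C5_endo_Inl[OF h V(1)] K2_join_C5_endo_Inr[OF h V(2)] by blast
  then have "g v = snd e" "g u = fst e"
    using eq[OF V(1)] eq[OF V(2)] by (simp_all add: g_def)
  then have "e = (g u, g v)" by simp
  with e h eq that show ?thesis by simp
qed

text \<open>A vertex and its retract lie in the same part of a gadget, and \<open>F\<close>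
  preserves parts. Although \<open>retract\<close> collapses edges inside a part, \<open>F\<close>
  thus descends along it.\<close>

lemma retract_hom_G_of:
  assumes D: "pair_digraph D" and col: "colorable 4 (mk_symmetric (with_proj D))"
    and F: "hom (G_of X) (G_of D) F" and z: "z \<in> pverts (G_of X)"
  shows "retract (F z) = retract (F (Orig (retract z)))"
  using z
proof (cases rule: G_of_vertex_cases)
  case (2 e x)
  obtain h where h: "hom K2_join_C5 K2_join_C5 h" "F (place e x) =
      place (retract (F (Orig (fst e))), retract (F (Orig (snd e)))) (h x)"
    using hom_G_of_place[OF D col F, of "fst e" "snd e"] 2 by auto
  then show ?thesis
    using 2 K2_join_C5_endo_Inl[OF h(1)] K2_join_C5_endo_Inr[OF h(1)] by (cases x) fastforce+
qed simp

lemma hom_G_of_inj_on_gadget: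
  assumes D: "pair_digraph D" and col: "colorable 4 (mk_symmetric (with_proj D))"
    and F: "hom (G_of X) (G_of D) F" and a: "e \<in> parcs X"
    and V: "x \<in> pverts K2_join_C5" "y \<in> pverts K2_join_C5"
    and eq: "F (place e x) = F (place e y)"
  shows "x = y"
proof -
  obtain u v where e: "e = (u, v)" by (cases e)
  obtain h where h: "(retract (F (Orig u)), retract (F (Orig v))) \<in> parcs D"
    "hom K2_join_C5 K2_join_C5 h"
    "\<And>x. x \<in> pverts K2_join_C5 \<Longrightarrow>
      F (place e x) = place (retract (F (Orig u)), retract (F (Orig v))) (h x)"
    using hom_G_of_place[OF D col F, of u v] a e by metis
  then show ?thesis
    using inj_place[OF D h(1)] inj_onD[OF inj_on_K2_join_C5_endo[OF h(2)]] V eq by metis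
qed

text \<open>The label of an inner image reveals the retracted images of both ends of
  \<open>e\<close>.\<close>

lemma hom_G_of_Inner_place:
  assumes D: "pair_digraph D" and col: "colorable 4 (mk_symmetric (with_proj D))"
    and F: "hom (G_of X) (G_of D) F" and e: "e \<in> parcs X"
    and x: "x \<in> pverts K2_join_C5" and eq: "F (place e x) = Inner e' p"
  shows "e' = (retract (F (Orig (fst e))), retract (F (Orig (snd e))))"
proof -
  obtain h where "F (place e x) =
      place (retract (F (Orig (fst e))), retract (F (Orig (snd e)))) (h x)"
    using hom_G_of_place[OF D col F, of "fst e" "snd e"] e x by auto
  with eq show ?thesis by (auto simp: place_def split: if_splits)
qed

text \<open>
  A common image of two inner vertices, if it is an inner vertex, determines the gadget. If it is
  not, then it is the retract of the image of the common end of the two gadgets, so that end must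
  itself be mapped to an inner vertex, which again determines the gadget.
\<close>

lemma hom_G_of_same_gadget:
  fixes X :: "'b pair_pre_digraph"
  assumes D: "pair_digraph D" and col: "colorable 4 (mk_symmetric (with_proj D))"
    and F: "hom (G_of X) (G_of D) F"
    and e: "e \<in> parcs X" "e' \<in> parcs X"
    and x: "x \<in> pverts K2_join_C5" "place e x = Inner e x"
    and y: "y \<in> pverts K2_join_C5" "place e' y = Inner e' y"
    and ret: "retract (Inner e x) = retract (Inner e' y)"
    and eq: "F (Inner e x) = F (Inner e' y)"
  shows "retract (F (Orig (fst e))) = retract (F (Orig (fst e'))) \<and>
    retract (F (Orig (snd e))) = retract (F (Orig (snd e')))"
proof -
  let ?V = "pverts K2_join_C5"
  let ?w = "retract (Inner e x)"
  obtain q where q: "q \<in> ?V" "Orig ?w = place e q" using Orig_retract_Inner by metis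
  obtain q' where q': "q' \<in> ?V" "Orig ?w = place e' q'" using Orig_retract_Inner ret by metis
  have "q \<noteq> x" using q(2) x(2) by auto
  note inner = hom_G_of_Inner_place[OF D col F]
  show ?thesis
  proof (cases "F (Inner e x)")
    case (Inner d p)
    then show ?thesis using inner[OF e(1) x(1), of d p] inner[OF e(2) y(1), of d p] x(2) y(2) eq
      by simp
  next
    case (Orig s)
    have "Inner e x \<in> pverts (G_of X)" using place_in_G_of[OF e(1) x(1)] x(2) by simp
    from retract_hom_G_of[OF D col F this] have "s = retract (F (Orig ?w))" using Orig by simp
    \<comment> \<open>The only original vertex with retract \<open>s\<close> is
      \<open>Orig s\<close>, already the image of another vertex of the same gadget.\<close>
    moreover have "F (Orig ?w) \<noteq> F (Inner e x)"
      using hom_G_of_inj_on_gadget[OF D col F e(1) q(1) x(1)] q(2) x(2) \<open>q \<noteq> x\<close> by auto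
    ultimately obtain d p where dp: "F (Orig ?w) = Inner d p"
      using Orig by (cases "F (Orig ?w)") auto
    then show ?thesis
      using inner[OF e(1) q(1), of d p] inner[OF e(2) q'(1), of d p] q(2) q'(2) by simp
  qed
qed

section \<open>Functoriality of \<open>G_of\<close>\<close>

fun G_map :: "('a \<Rightarrow> 'b) \<Rightarrow> 'a gvertex \<Rightarrow> 'b gvertex" where
  "G_map h (Orig u) = Orig (h u)"
| "G_map h (Inner e x) = Inner (map_prod h h e) x"

lemma G_map_place: "G_map h (place e x) = place (map_prod h h e) x"
  by (simp add: place_def)

lemma hom_G_map:
  assumes "hom X Y h"
  shows "hom (G_of X) (G_of Y) (G_map h)"
proof -
  have a: "map_prod h h e \<in> parcs Y" if "e \<in> parcs X" for e
    using assms that by (cases e) (auto simp: hom_def)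
  have "G_map h z \<in> pverts (G_of Y)" if "z \<in> pverts (G_of X)" for z
    using that
  proof (cases rule: G_of_vertex_cases)
    case (1 u)
    then show ?thesis using assms by (auto simp: hom_def G_of_def)
  next
    case (2 e x)
    then show ?thesis using a by (simp add: G_map_place place_in_G_of)
  qed
  moreover have "(G_map h y, G_map h z) \<in> parcs (G_of Y)" if yz: "(y, z) \<in> parcs (G_of X)" for y z
  proof -
    obtain e p q where "e \<in> parcs X" "(p, q) \<in> parcs K2_join_C5" "y = place e p" "z = place e q"
      using yz by (auto simp: G_of_def)
    then show ?thesis using a by (simp add: G_map_place place_arc_G_of)
  qed
  ultimately show ?thesis by (auto simp: hom_def)
qed

subsection \<open>Cores and products\<close>

text \<open>Following \<open>g\<close> by a homomorphism back to \<open>C\<close> gives an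
  endomorphism of \<open>C\<close>; the subdigraph induced on its image is still equivalent to
  \<open>X\<close>, so minimality forbids any loss of vertices.\<close>

lemma hom_core_inj_on:
  assumes C: "is_core_digraph C X" and g: "hom C X g"
  shows "inj_on g (pverts C)"
proof -
  have dC: "pair_digraph C" and eq: "hom_equiv C X" using C by (auto simp: is_core_digraph_def)
  obtain k where k: "hom X C k" using eq by (auto simp: hom_equiv_def)
  define C' where "C' = \<lparr> pverts = (k \<circ> g) ` pverts C,
    parcs = parcs C \<inter> ((k \<circ> g) ` pverts C) \<times> ((k \<circ> g) ` pverts C) \<rparr>"
  have kg: "hom C C (k \<circ> g)" by (rule hom_comp[OF g k])
  have "pair_digraph C'" using dC by (auto simp: pair_digraph_iff C'_def)
  moreover have "hom C C' (k \<circ> g)"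
    using kg dC by (fastforce simp: hom_def C'_def pair_digraph_iff)
  moreover have "hom C' C id" using kg by (auto simp: hom_def C'_def)
  ultimately have "card (pverts C) \<le> card (pverts C')"
    using is_core_digraph_le[OF C] hom_equiv_trans[OF _ eq] unfolding hom_equiv_def by blast
  then have "inj_on (k \<circ> g) (pverts C)"
    using dC card_image_le[of "pverts C" "k \<circ> g"]
    by (auto simp: C'_def pair_digraph_iff intro!: eq_card_imp_inj_on)
  then show ?thesis by (rule inj_on_imageI2)
qed

lemma hom_tensor_prod_proj:
  "i \<in> I \<Longrightarrow> hom X (tensor_prod I Y) f \<Longrightarrow> hom X (Y i) (\<lambda>x. f x i)"
  by (fastforce simp: hom_def tensor_prod_def)

lemma hom_tensor_prod_restrict:
  assumes "pair_digraph X" "\<And>i. i \<in> I \<Longrightarrow> hom X (Y i) (f i)"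
  shows "hom X (tensor_prod I Y) (\<lambda>x. \<lambda>i\<in>I. f i x)"
proof -
  have "x \<in> pverts X" "y \<in> pverts X" if "(x, y) \<in> parcs X" for x y
    using assms(1) that by (auto simp: pair_digraph_iff)
  then show ?thesis using assms(2) by (fastforce simp: hom_def tensor_prod_def)
qed

text \<open>The retracted map \<open>g\<close> is injective because \<open>C\<close> is a core, so
  vertices with equal images have equal retracts. It remains to separate vertices over a common
  retract, within one gadget or across two.\<close>

lemma hom_G_of_core_inj_on:
  fixes D :: "'i \<Rightarrow> 'a pair_pre_digraph"
  assumes dig: "\<And>i. i \<in> I \<Longrightarrow> pair_digraph (D i)"
    and col: "\<And>i. i \<in> I \<Longrightarrow> colorable 4 (mk_symmetric (with_proj (D i)))"
    and C: "is_core_digraph C (tensor_prod I D)"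
    and F: "hom (G_of C) (tensor_prod I (\<lambda>i. G_of (D i))) F"
    and "I \<noteq> {}"
  shows "inj_on F (pverts (G_of C))"
proof (rule inj_onI)
  have dC: "pair_digraph C" using C by (simp add: is_core_digraph_def)
  have Fi: "hom (G_of C) (G_of (D i)) (\<lambda>z. F z i)" if "i \<in> I" for i
    using hom_tensor_prod_proj[OF that F] .
  define g where "g u = (\<lambda>i\<in>I. retract (F (Orig u) i))" for u
  have "hom C (D i) (\<lambda>u. retract (F (Orig u) i))" if "i \<in> I" for i
    unfolding hom_def
  proof (intro conjI ballI, goal_cases)
    case (1 u)
    then have "Orig u \<in> pverts (G_of C)" by (auto simp: G_of_def)
    then have "F (Orig u) i \<in> pverts (G_of (D i))" using Fi[OF that] by (auto simp: hom_def)
    then show ?case by (rule retract_in_pverts[OF dig[OF that]])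
  next
    case (2 e)
    then show ?case
      using hom_G_of_place[OF dig[OF that] col[OF that] Fi[OF that], of "fst e" "snd e"]
      by (cases e) auto
  qed
  then have "hom C (tensor_prod I D) g"
    unfolding g_def by (rule hom_tensor_prod_restrict[OF dC])
  then have inj: "inj_on g (pverts C)" by (rule hom_core_inj_on[OF C])
  have inj': "u = v"
    if "u \<in> pverts C" "v \<in> pverts C"
      "\<And>i. i \<in> I \<Longrightarrow> retract (F (Orig u) i) = retract (F (Orig v) i)" for u v
  proof (rule inj_onD[OF inj])
    show "g u = g v" unfolding g_def using that(3) by (rule restrict_ext)
  qed (use that in auto)
  \<comment> \<open>A single coordinate suffices for injectivity inside a gadget.\<close>
  obtain i0 where i0: "i0 \<in> I" using \<open>I \<noteq> {}\<close> by blast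
  have gadget: "p = q" if "F (place e p) = F (place e q)" "e \<in> parcs C"
    "p \<in> pverts K2_join_C5" "q \<in> pverts K2_join_C5" for e p q
    using hom_G_of_inj_on_gadget[OF dig[OF i0] col[OF i0] Fi[OF i0] that(2-4)] that(1) by simp
  fix x y assume x: "x \<in> pverts (G_of C)" and y: "y \<in> pverts (G_of C)" and eq: "F x = F y"
  have ret: "retract x = retract y"
  proof (rule inj')
    show "retract x \<in> pverts C" "retract y \<in> pverts C" using retract_in_pverts[OF dC] x y by auto
    show "retract (F (Orig (retract x)) i) = retract (F (Orig (retract y)) i)" if "i \<in> I" for i
      using retract_hom_G_of[OF dig[OF that] col[OF that] Fi[OF that] x]
        retract_hom_G_of[OF dig[OF that] col[OF that] Fi[OF that] y] eq by simp
  qed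
  have InnerD: "e \<in> parcs C" "p \<in> pverts K2_join_C5" "place e p = Inner e p"
    if "Inner e p \<in> pverts (G_of C)" for e p
    using that by (auto simp: G_of_def place_def split: if_splits)
  have mixed: False
    if "Inner e p \<in> pverts (G_of C)" "F (Inner e p) = F (Orig (retract (Inner e p)))" for e p
    using gadget[of e p] InnerD[OF that(1)] that(2) Orig_retract_Inner[of e p] by (metis gvertex.distinct(1))
  show "x = y"
  proof (cases x)
    case xO: (Orig u)
    show ?thesis
    proof (cases y)
      case (Orig v)
      then show ?thesis using ret xO by simp
    next
      case (Inner e p)
      then show ?thesis using mixed[of e p] xO ret eq y by simp
    qed
  next
    case xI: (Inner e p)
    show ?thesis
    proof (cases y)
      case (Orig v)
      then show ?thesis using mixed[of e p] xI ret eq x by simp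
    next
      case yI: (Inner e' p')
      note xD = InnerD[OF x[unfolded xI]] and yD = InnerD[OF y[unfolded yI]]
      \<comment> \<open>Different coordinates may identify the gadgets for different reasons, but
        agreement at both ends in all of them forces \<open>e = e'\<close>.\<close>
      have same: "retract (F (Orig (fst e)) i) = retract (F (Orig (fst e')) i) \<and>
          retract (F (Orig (snd e)) i) = retract (F (Orig (snd e')) i)" if "i \<in> I" for i
        using hom_G_of_same_gadget[OF dig[OF that] col[OF that] Fi[OF that] xD(1) yD(1) xD(2,3) yD(2,3)]
          ret eq xI yI by simp
      have "fst e \<in> pverts C" "snd e \<in> pverts C" "fst e' \<in> pverts C" "snd e' \<in> pverts C"
        using dC xD(1) yD(1) by (auto simp: pair_digraph_iff)
      then have "e = e'" using inj' same by (intro prod_eqI) blast+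
      then show ?thesis using gadget[of e p p'] xD yD eq xI yI by simp
    qed
  qed
qed

theorem theorem45:
  fixes I :: "'i set"
    and D :: "'i \<Rightarrow> 'a pair_pre_digraph"
    and C :: "'c pair_pre_digraph"
    and H :: "'h pair_pre_digraph"
  assumes "finite I"
    and "\<And>i. i \<in> I \<Longrightarrow> pair_digraph (D i)"
    and "\<And>i. i \<in> I \<Longrightarrow> colorable 4 (mk_symmetric (with_proj (D i)))"
    and "is_core_digraph C (tensor_prod I D)"
    and "is_core_graph H (tensor_prod I (\<lambda>i. G_of (D i)))"
  shows "card (pverts (G_of C)) \<le> card (pverts H)"
proof -
  let ?P = "tensor_prod I (\<lambda>i. G_of (D i))"
  have dC: "pair_digraph C" and dH: "pair_digraph H"
    using assms(4,5) by (auto simp: is_core_digraph_def is_core_graph_def pair_graph_iff)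
  obtain s t where s: "hom C (tensor_prod I D) s" and t: "hom (tensor_prod I D) C t"
    using assms(4) by (auto simp: is_core_digraph_def hom_equiv_def)
  obtain a b where a: "hom H ?P a" and b: "hom ?P H b"
    using assms(5) by (auto simp: is_core_graph_def hom_equiv_def)
  \<comment> \<open>The empty product has a loop, which cannot map to the loopless
    \<open>C\<close>.\<close>
  have "I \<noteq> {}"
  proof
    assume "I = {}"
    then have "((\<lambda>_. undefined), (\<lambda>_. undefined)) \<in> parcs (tensor_prod I D)"
      by (simp add: tensor_prod_def)
    then have "(t (\<lambda>_. undefined), t (\<lambda>_. undefined)) \<in> parcs C" using t by (auto simp: hom_def)
    then show False using dC by (auto simp: pair_digraph_iff)
  qed
  have dG: "pair_digraph (G_of C)" using pair_graph_G_of[OF dC] by (simp add: pair_graph_iff)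
  \<comment> \<open>Coordinates of \<open>s\<close> are lifted by functoriality and reassembled into
    a map to the product, then sent on to \<open>H\<close>.\<close>
  have "hom (G_of C) (G_of (D i)) (G_map (\<lambda>u. s u i))" if "i \<in> I" for i
    by (rule hom_G_map[OF hom_tensor_prod_proj[OF that s]])
  then have "hom (G_of C) ?P (\<lambda>z. \<lambda>i\<in>I. G_map (\<lambda>u. s u i) z)"
    by (rule hom_tensor_prod_restrict[OF dG])
  from hom_comp[OF this b] obtain k where k: "hom (G_of C) H k" by blast
  from hom_comp[OF k a] have "inj_on (a \<circ> k) (pverts (G_of C))"
    using hom_G_of_core_inj_on[OF assms(2,3,4) _ \<open>I \<noteq> {}\<close>] by blast
  then have "inj_on k (pverts (G_of C))" by (rule inj_on_imageI2)
  moreover have "k ` pverts (G_of C) \<subseteq> pverts H" using k by (auto simp: hom_def)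
  ultimately show ?thesis using dH by (intro card_inj_on_le) (auto simp: pair_digraph_iff)
qed

end
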